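(* For the triangle game on the triangular grid with $n$ winning sets, $\mathrm{SC}_2(\mathcal G_{\triangle},3)\ge \frac{n}{28}-o(n)$.
   Context: An $s$-of-$k$ game on a $k$-uniform hypergraph $(V,\mathcal F)$ (winning sets are $k$-element subsets of the finite set $V$), $1\le s\le k$: Maker and Breaker alternately claim unclaimed vertices, Maker first, until all are claimed; the score is the number of winning sets in which Maker claimed at least $s$ vertices (Maker maximizes, Breaker minimizes). A pairing strategy for Maker: she fixes in advance pairwise disjoint pairs of vertices and, whenever Breaker claims a vertex of a pair whose partner is unclaimed, she claims the partner (other moves arbitrary). $\mathrm{SC}_2(\mathcal H,s)$ is the largest score Maker can guarantee against every Breaker strategy using a pairing strategy. $\mathcal G_{\triangle}$ is the hypergraph whose vertices are the points of a finite portion of the triangular lattice and whose winning sets are the vertex sets of the unit triangular faces (both orientations), so $k=3$. Grids are assumed "two-dimensional": the number of winning sets within constant distance of the boundary is $o(n)$, where $n$ is the number of winning sets; $o(n)$ refers to $n\to\infty$. *)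

theory Defs
  imports "HOL-Library.Landau_Symbols"
begin

text \<open>
  A position is the list of vertices claimed so far, in order of play. Maker moves first, so she
  owns the entries with even index. A strategy is a function from positions to the next vertex.
\<close>

definition maker_claims :: "'a list \<Rightarrow> 'a set" where
  "maker_claims h = {h ! i | i. i < length h \<and> even i}"

definition score :: "'a set set \<Rightarrow> nat \<Rightarrow> 'a list \<Rightarrow> nat" where
  "score F s h = card {S \<in> F. s \<le> card (S \<inter> maker_claims h)}"

definition legal_strategy :: "'a set \<Rightarrow> ('a list \<Rightarrow> 'a) \<Rightarrow> bool" where
  "legal_strategy V f \<longleftrightarrow> (\<forall>h. distinct h \<and> set h \<subset> V \<longrightarrow> f h \<in> V - set h)"

primrec play :: "('a list \<Rightarrow> 'a) \<Rightarrow> ('a list \<Rightarrow> 'a) \<Rightarrow> nat \<Rightarrow> 'a list" where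
  "play \<sigma> \<tau> 0 = []"
| "play \<sigma> \<tau> (Suc i) =
     play \<sigma> \<tau> i @ [if even i then \<sigma> (play \<sigma> \<tau> i) else \<tau> (play \<sigma> \<tau> i)]"

definition pairing :: "'a set \<Rightarrow> 'a set set \<Rightarrow> bool" where
  "pairing V P \<longleftrightarrow> (\<forall>p\<in>P. p \<subseteq> V \<and> card p = 2) \<and> pairwise disjnt P"

text \<open>
  In the position \<open>h @ [v]\<close> with \<open>length h\<close> odd, Breaker has just claimed \<open>v\<close>. All moves not
  forced by \<open>P\<close> are unconstrained.
\<close>

definition pairing_strategy :: "'a set \<Rightarrow> 'a set set \<Rightarrow> ('a list \<Rightarrow> 'a) \<Rightarrow> bool" where
  "pairing_strategy V P \<sigma> \<longleftrightarrow> legal_strategy V \<sigma> \<and>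
     (\<forall>h v w. distinct (h @ [v]) \<and> set (h @ [v]) \<subseteq> V \<and> odd (length h) \<and>
        {v, w} \<in> P \<and> w \<notin> set (h @ [v]) \<longrightarrow> \<sigma> (h @ [v]) = w)"

text \<open>
  A score is guaranteed by a pairing if it is reached however Maker makes her arbitrary moves.
  Letting her choose these moves optimally instead would make the empty pairing subsume all
  strategies.
\<close>

definition pairing_guarantees ::
  "'a set \<Rightarrow> 'a set set \<Rightarrow> nat \<Rightarrow> 'a set set \<Rightarrow> nat \<Rightarrow> bool" where
  "pairing_guarantees V F s P v \<longleftrightarrow>
     (\<forall>\<sigma> \<tau>. pairing_strategy V P \<sigma> \<and> legal_strategy V \<tau> \<longrightarrow>
        v \<le> score F s (play \<sigma> \<tau> (card V)))"

definition SC2 :: "'a set \<Rightarrow> 'a set set \<Rightarrow> nat \<Rightarrow> nat" where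
  "SC2 V F s = Max {v. \<exists>P. pairing V P \<and> pairing_guarantees V F s P v}"

text \<open>The maximum above is taken over a finite nonempty set.\<close>

lemma legal_strategy_exists: "\<exists>\<tau>. legal_strategy V \<tau>"
proof -
  have "(SOME x. x \<in> V - set h) \<in> V - set h" if "set h \<subset> V" for h
    using psubset_imp_ex_mem[OF that] by (rule someI_ex)
  then have "legal_strategy V (\<lambda>h. SOME x. x \<in> V - set h)"
    by (simp add: legal_strategy_def)
  then show ?thesis by blast
qed

lemma pairing_strategy_exists:
  assumes "pairing V P"
  shows "\<exists>\<sigma>. pairing_strategy V P \<sigma>"
proof -
  obtain \<tau> where \<tau>: "legal_strategy V \<tau>" using legal_strategy_exists by blast
  define Q where "Q h w \<longleftrightarrow> h \<noteq> [] \<and> {last h, w} \<in> P \<and> w \<notin> set h" for h :: "'a list" and w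
  define \<sigma> where "\<sigma> h = (if \<exists>w. Q h w then SOME w. Q h w else \<tau> h)" for h
  have in_V: "w \<in> V" if "Q h w" for h w
    using that assms unfolding Q_def pairing_def by blast
  have unique: "w = w'" if "Q h w" "Q h w'" for h w w'
  proof -
    have "pairwise disjnt P" "{last h, w} \<in> P" "{last h, w'} \<in> P"
      using that assms by (simp_all add: Q_def pairing_def)
    moreover have "\<not> disjnt {last h, w} {last h, w'}" by (simp add: disjnt_def)
    ultimately have "{last h, w} = {last h, w'}" by (meson pairwiseD)
    then show ?thesis by (auto simp: doubleton_eq_iff)
  qed
  have \<sigma>_Q: "\<sigma> h = w" if "Q h w" for h w
    using someI[of "Q h" w] unique[of h] that unfolding \<sigma>_def by auto
  have "legal_strategy V \<sigma>"
    unfolding legal_strategy_def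
  proof (intro allI impI)
    fix h :: "'a list" assume h: "distinct h \<and> set h \<subset> V"
    show "\<sigma> h \<in> V - set h"
    proof (cases "\<exists>w. Q h w")
      case True
      then obtain w where w: "Q h w" by blast
      then show ?thesis using \<sigma>_Q[OF w] in_V[OF w] by (simp add: Q_def)
    next
      case False
      then show ?thesis using \<tau> h by (simp add: \<sigma>_def legal_strategy_def)
    qed
  qed
  moreover have "\<sigma> (h @ [v]) = w" if "{v, w} \<in> P" "w \<notin> set (h @ [v])" for h v w
    using that by (intro \<sigma>_Q) (simp add: Q_def)
  ultimately show ?thesis unfolding pairing_strategy_def by blast
qed

lemma SC2_set_finite:
  assumes "finite F"
  shows "finite {v. \<exists>P. pairing V P \<and> pairing_guarantees V F s P v}"
proof (rule finite_subset)
  show "{v. \<exists>P. pairing V P \<and> pairing_guarantees V F s P v} \<subseteq> {..card F}"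
  proof (rule subsetI, elim CollectE exE conjE)
    fix v P assume P: "pairing V P" and g: "pairing_guarantees V F s P v"
    obtain \<sigma> \<tau> where "pairing_strategy V P \<sigma>" "legal_strategy V \<tau>"
      using pairing_strategy_exists[OF P] legal_strategy_exists by blast
    then have "v \<le> score F s (play \<sigma> \<tau> (card V))"
      using g unfolding pairing_guarantees_def by blast
    also have "\<dots> \<le> card F"
      unfolding score_def by (rule card_mono) (use assms in auto)
    finally show "v \<in> {..card F}" by simp
  qed
qed simp

lemma SC2_set_nonempty: "0 \<in> {v. \<exists>P. pairing V P \<and> pairing_guarantees V F s P v}"
proof -
  have "pairing V {} \<and> pairing_guarantees V F s {} 0"
    by (simp add: pairing_def pairing_guarantees_def)
  then show ?thesis by blast
qed

text \<open>
  The pair \<open>(a, b)\<close> stands for the lattice point \<open>a e\<^sub>1 + b e\<^sub>2\<close>, where \<open>e\<^sub>1, e\<^sub>2\<close> are unit vectors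
  at an angle of 60 degrees. Thus the neighbours of the origin are \<open>\<plusminus>(1,0)\<close>, \<open>\<plusminus>(0,1)\<close>, \<open>\<plusminus>(1,-1)\<close>,
  and \<open>lattice_dist\<close> is the graph distance in the lattice.
\<close>

type_synonym point = "int \<times> int"

definition face_up :: "point \<Rightarrow> point set" where
  "face_up = (\<lambda>(a, b). {(a, b), (a + 1, b), (a, b + 1)})"

definition face_down :: "point \<Rightarrow> point set" where
  "face_down = (\<lambda>(a, b). {(a + 1, b), (a, b + 1), (a + 1, b + 1)})"

definition lattice_dist :: "point \<Rightarrow> point \<Rightarrow> int" where
  "lattice_dist = (\<lambda>(a, b) (c, d).
     max \<bar>a - c\<bar> (max \<bar>b - d\<bar> \<bar>(a + b) - (c + d)\<bar>))"

definition triangles :: "point set \<Rightarrow> point set set" where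
  "triangles V = {T. T \<subseteq> V \<and> (T \<in> range face_up \<or> T \<in> range face_down)}"

definition boundary :: "point set \<Rightarrow> point set" where
  "boundary V = {u \<in> V. \<exists>w. w \<notin> V \<and> lattice_dist u w = 1}"

definition triangles_near_boundary :: "nat \<Rightarrow> point set \<Rightarrow> point set set" where
  "triangles_near_boundary r V =
     {T \<in> triangles V. \<exists>u\<in>T. \<exists>w\<in>boundary V. lattice_dist u w \<le> int r}"

text \<open>
  Two-dimensionality constrains a family of grids, not a single one: for every radius \<open>r\<close> the
  number of triangles within distance \<open>r\<close> of the boundary is \<open>o(n)\<close>, uniformly over the grids of
  the family with \<open>n\<close> triangles.
\<close>

definition two_dimensional :: "point set set \<Rightarrow> bool" where
  "two_dimensional \<G> \<longleftrightarrow>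
     (\<forall>r. \<exists>\<beta> :: nat \<Rightarrow> real. \<beta> \<in> o(\<lambda>n. real n) \<and>
        (\<forall>V\<in>\<G>. real (card (triangles_near_boundary r V)) \<le> \<beta> (card (triangles V))))"

end

theory Submission
  imports Defs "HOL-Library.Product_Plus"
begin

text \<open>
  A pairing strategy lets Maker claim at least one vertex of every pair, and Breaker decides which.
  Reading each pair as a literal and its negation, Breaker needs an assignment under which every
  face contains a literal lost by Maker. A set of faces for which this formula is unsatisfiable
  therefore contains a face that Maker completes. Six pairs on twelve points, found by computer
  search, achieve this. The values of \<open>a + 3 b\<close> on these points run through all residues modulo
  12, so the translates by the lattice \<open>12 dvd a + 3 b\<close> tile the plane. There are two faces per
  point, hence 24 per tile, and only faces near the boundary belong to incomplete tiles. This gives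
  \<open>n / 24 - o(n)\<close>.
\<close>

section \<open>Pairing strategies\<close>

lemma length_play [simp]: "length (play \<sigma> \<tau> i) = i"
  by (induction i) auto

lemma play_invariant:
  assumes "finite V" "legal_strategy V \<sigma>" "legal_strategy V \<tau>" "i \<le> card V"
  shows "distinct (play \<sigma> \<tau> i) \<and> set (play \<sigma> \<tau> i) \<subseteq> V"
  using assms(4)
proof (induction i)
  case 0
  then show ?case by simp
next
  case (Suc i)
  let ?h = "play \<sigma> \<tau> i"
  have h: "distinct ?h" "set ?h \<subseteq> V" using Suc by auto
  then have "card (set ?h) < card V" using Suc.prems by (simp add: distinct_card)
  then have "set ?h \<subset> V" using h by auto
  then have "\<sigma> ?h \<in> V - set ?h" "\<tau> ?h \<in> V - set ?h"
    using assms h by (auto simp: legal_strategy_def)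
  then show ?case using h by auto
qed

lemma take_play: "i \<le> n \<Longrightarrow> take i (play \<sigma> \<tau> n) = play \<sigma> \<tau> i"
proof (induction n)
  case (Suc n)
  then show ?case by (cases "i = Suc n") auto
qed simp

text \<open>If Breaker owned both points of a pair, then right after his earlier claim the partner
  was still free, so Maker's forced reply took it.\<close>

lemma pairing_strategy_claims:
  assumes "finite V" "pairing V P" "pairing_strategy V P \<sigma>" "legal_strategy V \<tau>" "p \<in> P"
  shows "p \<inter> maker_claims (play \<sigma> \<tau> (card V)) \<noteq> {}"
proof
  let ?n = "card V" and ?h = "play \<sigma> \<tau> (card V)"
  assume none: "p \<inter> maker_claims ?h = {}"
  have \<sigma>: "legal_strategy V \<sigma>" using assms(3) by (simp add: pairing_strategy_def)
  note inv = play_invariant[OF assms(1) \<sigma> assms(4)]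
  have h: "distinct ?h" "set ?h \<subseteq> V" using inv by auto
  then have set_h: "set ?h = V"
    using card_subset_eq[OF assms(1) h(2)] distinct_card[OF h(1)] by simp
  have no: False if "{v, w} = p" "i < j" "j < ?n" "v = ?h ! i" "w = ?h ! j" "odd i" "odd j" for v w i j
  proof -
    have i: "play \<sigma> \<tau> (Suc i) = play \<sigma> \<tau> i @ [v]"
      using that take_play[of "Suc i" ?n \<sigma> \<tau>] take_play[of i ?n \<sigma> \<tau>]
      by (simp add: take_Suc_conv_app_nth del: play.simps)
    have "w \<notin> set (play \<sigma> \<tau> (Suc i))"
    proof
      assume "w \<in> set (play \<sigma> \<tau> (Suc i))"
      then have "w \<in> set (take (Suc i) ?h)"
        using that take_play[of "Suc i" ?n \<sigma> \<tau>] by (simp del: play.simps)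
      then show False
        using that h by (auto simp: in_set_conv_nth nth_eq_iff_index_eq)
    qed
    then have "\<sigma> (play \<sigma> \<tau> (Suc i)) = w"
      using assms(3,5) that inv[of i] inv[of "Suc i"] unfolding pairing_strategy_def i by auto
    then have "play \<sigma> \<tau> (Suc (Suc i)) = play \<sigma> \<tau> (Suc i) @ [w]"
      using that by (subst play.simps) simp
    \<comment> \<open>Both indices are odd, so the reply at index \<open>Suc i\<close> strictly
      precedes \<open>j\<close>. The point \<open>w\<close> then stands at two indices of a distinct
      list.\<close>
    moreover have "Suc i < j" using that by (metis Suc_lessI even_Suc)
    ultimately have "take (Suc (Suc i)) ?h ! Suc i = w"
      using that take_play[of "Suc (Suc i)" ?n \<sigma> \<tau>] by (simp add: nth_append del: play.simps)
    then show False
      using h that \<open>Suc i < j\<close> by (simp add: nth_eq_iff_index_eq)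
  qed
  obtain v w where p: "p = {v, w}" "v \<noteq> w" "v \<in> V" "w \<in> V"
    using assms(2,5) unfolding pairing_def by (metis card_2_iff insert_subset)
  have "v \<in> set ?h" "w \<in> set ?h" using p set_h by simp_all
  then obtain i j where ij: "v = ?h ! i" "i < ?n" "w = ?h ! j" "j < ?n"
    unfolding in_set_conv_nth length_play by blast
  then have "odd i" "odd j" "i \<noteq> j"
    using none p h unfolding maker_claims_def by auto
  then show False
    using no[of v w i j] no[of w v j i] p ij by (cases i j rule: linorder_cases) auto
qed

text \<open>Eliminates the game: all that is kept of Maker's final set is that it meets every
  pair.\<close>

lemma SC2_geI:
  assumes "finite V" "finite F" "pairing V P"
    and "\<And>M. (\<And>p. p \<in> P \<Longrightarrow> p \<inter> M \<noteq> {}) \<Longrightarrow> k \<le> card {S \<in> F. s \<le> card (S \<inter> M)}"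
  shows "k \<le> SC2 V F s"
proof -
  have "pairing_guarantees V F s P k"
    unfolding pairing_guarantees_def score_def
    using assms(4) pairing_strategy_claims[OF assms(1,3)] by blast
  then show ?thesis
    unfolding SC2_def using SC2_set_finite[OF assms(2)] assms(3) by (intro Max_ge) auto
qed

section \<open>The tile\<close>

text \<open>The twelve points form two hexagons with centres (1,3) and (2,1), glued along the edge
  from (1,2) to (2,2). One pair consists of the two centres and one of the ends of the glued edge.
  On each hexagon the other four rim points, in order p, q, r, s, give the interleaved pairs {p, r}
  and {q, s}.\<close>

definition tile_pairs :: "point set set" where
  "tile_pairs = {{(0,3), (1,4)}, {(0,4), (2,3)}, {(1,1), (3,0)},
                 {(1,2), (2,2)}, {(1,3), (2,1)}, {(2,0), (3,1)}}"

definition tile :: "point set" where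
  "tile = \<Union> tile_pairs"

text \<open>These are the translation vectors of the tiles, a lattice of index 12; the vector (0,0)
  does not itself lie in \<open>tile\<close>.\<close>

definition centres :: "point set" where
  "centres = {(a, b). 12 dvd a + 3 * b}"

lemmas tile_eq = tile_def[unfolded tile_pairs_def, simplified]

text \<open>Maker owns a hexagon centre, so two adjacent rim points of that hexagon suffice. Let p,
  q, r, s be the rim points off the glued edge, in order. She owns an end of that edge, say the one
  next to p. If she owns p, she is done; otherwise she owns r, and her point of {q, s} is adjacent
  to r. The other end is symmetric.\<close>

lemma tile_hit_triangle:
  assumes "\<And>p. p \<in> tile_pairs \<Longrightarrow> p \<inter> M \<noteq> {}"
  shows "\<exists>T\<in>triangles tile. T \<subseteq> M"
proof (rule ccontr)
  assume *: "\<not> ?thesis"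
  have "\<not> face_up x \<subseteq> M" if "face_up x \<subseteq> tile" for x
    using * that by (auto simp: triangles_def)
  note up = this[of "(_, _)", unfolded face_up_def tile_eq, simplified]
  have "\<not> face_down x \<subseteq> M" if "face_down x \<subseteq> tile" for x
    using * that by (auto simp: triangles_def)
  note down = this[of "(_, _)", unfolded face_down_def tile_eq, simplified]
  have hit: "x \<in> M \<or> y \<in> M" if "{x, y} \<in> tile_pairs" for x y
    using assms[OF that] by auto
  note pairs = hit[unfolded tile_pairs_def]
  show False
    \<comment> \<open>These are the ten faces formed by a hexagon centre and a rim edge other than
      the glued one. With the six pairs they give an unsatisfiable set of clauses.\<close>
    using up[of 0 3] up[of 1 1] up[of 1 3] up[of 2 0] up[of 2 1]
      down[of 0 2] down[of 0 3] down[of 1 0] down[of 1 2] down[of 2 0]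
      pairs[of "(0,3)" "(1,4)"] pairs[of "(0,4)" "(2,3)"] pairs[of "(1,1)" "(3,0)"]
      pairs[of "(1,2)" "(2,2)"] pairs[of "(1,3)" "(2,1)"] pairs[of "(2,0)" "(3,1)"]
    by simp argo
qed

lemma tile_residues_distinct:
  assumes "x \<in> tile" "y \<in> tile" "12 dvd (fst x + 3 * snd x) - (fst y + 3 * snd y)"
  shows "x = y"
  using assms by (auto simp: tile_eq)

text \<open>The form \<open>a + 3 * b\<close> is additive and vanishes modulo 12 on
  \<open>centres\<close>, so the residue of a common point determines its position in the
  tile.\<close>

lemma translated_tiles_disjoint:
  assumes "z \<in> centres" "z' \<in> centres" "x \<in> tile" "x' \<in> tile" "z + x = z' + x'"
  shows "z = z' \<and> x = x'"
proof -
  obtain a b where z: "z = (a, b)" by fastforce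
  obtain a' b' where z': "z' = (a', b')" by fastforce
  obtain c d where x: "x = (c, d)" by fastforce
  obtain c' d' where x': "x' = (c', d')" by fastforce
  have eq: "a + c = a' + c'" "b + d = b' + d'" using assms(5) by (auto simp: z z' x x')
  have "12 dvd a + 3 * b" "12 dvd a' + 3 * b'" using assms by (auto simp: centres_def z z')
  then have "12 dvd (a' + 3 * b') - (a + 3 * b)" by (rule dvd_diff[rotated])
  moreover have "(a' + 3 * b') - (a + 3 * b) = (c + 3 * d) - (c' + 3 * d')" using eq by linarith
  ultimately have "x = x'"
    using tile_residues_distinct[of x x'] assms by (simp add: x x')
  then show ?thesis using assms(5) by simp
qed

lemma face_translate:
  "(+) z ` face_up x = face_up (z + x)" "(+) z ` face_down x = face_down (z + x)"
  by (cases z; cases x; simp add: face_up_def face_down_def add.assoc)+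

lemma triangles_translate:
  assumes "T \<in> triangles U" "(+) z ` U \<subseteq> V"
  shows "(+) z ` T \<in> triangles V"
proof -
  obtain x where "T = face_up x \<or> T = face_down x"
    using assms(1) by (auto simp: triangles_def)
  then have "(+) z ` T = face_up (z + x) \<or> (+) z ` T = face_down (z + x)"
    using face_translate[of z x] by auto
  moreover have "(+) z ` T \<subseteq> V" using assms by (auto simp: triangles_def)
  ultimately show ?thesis unfolding triangles_def by blast
qed

lemma card_triangle: "T \<in> triangles V \<Longrightarrow> card T = 3"
proof -
  assume "T \<in> triangles V"
  then obtain x where "T = face_up x \<or> T = face_down x"
    by (auto simp: triangles_def)
  then show ?thesis by (cases x) (auto simp: face_up_def face_down_def)
qed

lemma finite_triangles: "finite V \<Longrightarrow> finite (triangles V)"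
  by (rule finite_subset[of _ "Pow V"]) (auto simp: triangles_def)

definition full_centres :: "point set \<Rightarrow> point set" where
  "full_centres V = {z \<in> centres. (+) z ` tile \<subseteq> V}"

lemma finite_full_centres:
  assumes "finite V"
  shows "finite (full_centres V)"
proof (rule finite_surj[OF assms])
  \<comment> \<open>Since (0,3) belongs to \<open>tile\<close>, a full centre is recovered from the
    point \<open>z + (0, 3)\<close> of \<open>V\<close>.\<close>
  show "full_centres V \<subseteq> (\<lambda>v. v - (0, 3)) ` V"
    by (force simp: full_centres_def tile_eq image_iff)
qed

text \<open>Maker plays the translated pairs in every complete tile at once; each such tile yields a
  completed face of its own.\<close>

lemma card_full_centres_le_SC2:
  assumes "finite V"
  shows "card (full_centres V) \<le> SC2 V (triangles V) 3"
proof (rule SC2_geI)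
  let ?P = "{(+) z ` p | z p. z \<in> full_centres V \<and> p \<in> tile_pairs}"
  have pt: "p \<subseteq> tile" if "p \<in> tile_pairs" for p
    using that by (auto simp: tile_def)
  have card2: "card p = 2" if "p \<in> tile_pairs" for p
    using that by (auto simp: tile_pairs_def)
  have "pairwise disjnt tile_pairs"
    by (simp add: tile_pairs_def pairwise_def disjnt_def)
  then have disj: "p = q" if "p \<in> tile_pairs" "q \<in> tile_pairs" "x \<in> p" "x \<in> q" for p q x
    using that by (meson disjnt_iff pairwiseD)
  show "pairing V ?P"
    unfolding pairing_def
  proof (intro conjI ballI pairwiseI)
    fix p assume "p \<in> ?P"
    then obtain z p' where p: "p = (+) z ` p'" "(+) z ` tile \<subseteq> V" "p' \<in> tile_pairs"
      unfolding full_centres_def by blast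
    then show "p \<subseteq> V" using image_mono[OF pt, of p' "(+) z"] by simp
    show "card p = 2" using p card2 by (simp add: card_image)
  next
    fix p q assume "p \<in> ?P" "q \<in> ?P" "p \<noteq> q"
    then obtain z p' z' q' where pq: "p = (+) z ` p'" "q = (+) z' ` q'" "z \<in> centres" "z' \<in> centres"
      "p' \<in> tile_pairs" "q' \<in> tile_pairs"
      unfolding full_centres_def by blast
    have False if "x \<in> p'" "x' \<in> q'" "z + x = z' + x'" for x x'
    proof -
      have "z = z' \<and> x = x'"
        using translated_tiles_disjoint[of z z' x x'] pt pq that by auto
      then show False using disj[of p' q' x] pq that \<open>p \<noteq> q\<close> by auto
    qed
    then show "disjnt p q" unfolding disjnt_def pq(1,2) by blast
  qed
next
  fix M :: "point set"
  assume M: "\<And>p. p \<in> {(+) z ` p | z p. z \<in> full_centres V \<and> p \<in> tile_pairs} \<Longrightarrow> p \<inter> M \<noteq> {}"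
  let ?S = "{T \<in> triangles V. 3 \<le> card (T \<inter> M)}"
  have "\<exists>T\<in>triangles tile. (+) z ` T \<subseteq> M" if "z \<in> full_centres V" for z
  proof -
    \<comment> \<open>Maker's set is pulled back along the translation, so that the result on the
      single tile at the origin applies.\<close>
    have "p \<inter> {x. z + x \<in> M} \<noteq> {}" if "p \<in> tile_pairs" for p
    proof -
      have "(+) z ` p \<inter> M \<noteq> {}" using that \<open>z \<in> full_centres V\<close> by (intro M) blast
      then show ?thesis by auto
    qed
    then obtain T where "T \<in> triangles tile" "T \<subseteq> {x. z + x \<in> M}"
      using tile_hit_triangle by blast
    then show ?thesis by blast
  qed
  then obtain t where t: "\<And>z. z \<in> full_centres V \<Longrightarrow> t z \<in> triangles tile \<and> (+) z ` t z \<subseteq> M"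
    by metis
  show "card (full_centres V) \<le> card ?S"
  proof (rule card_inj_on_le)
    show "(\<lambda>z. (+) z ` t z) ` full_centres V \<subseteq> ?S"
    proof safe
      fix z assume z: "z \<in> full_centres V"
      then show *: "(+) z ` t z \<in> triangles V"
        using t triangles_translate[of "t z" tile z V] by (simp add: full_centres_def)
      show "3 \<le> card ((+) z ` t z \<inter> M)"
        using card_triangle[OF *] t[OF z] by (simp add: Int_absorb2)
    qed
    show "finite ?S" using finite_triangles[OF assms] by simp
    show "inj_on (\<lambda>z. (+) z ` t z) (full_centres V)"
    proof (rule inj_onI)
      fix z z' assume z: "z \<in> full_centres V" "z' \<in> full_centres V"
        and eq: "(+) z ` t z = (+) z' ` t z'"
      have "t z \<noteq> {}" using card_triangle[of "t z" tile] t[OF z(1)] by auto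
      then obtain x x' where "x \<in> t z" "x' \<in> t z'" "z + x = z' + x'" using eq by blast
      moreover have "t z \<subseteq> tile" "t z' \<subseteq> tile" using t z by (auto simp: triangles_def)
      ultimately show "z = z'"
        using translated_tiles_disjoint[of z z' x x'] z by (auto simp: full_centres_def)
    qed
  qed
qed (use assms finite_triangles in auto)

section \<open>Counting faces\<close>

lemma lattice_dist_le_iff:
  "lattice_dist x y \<le> r \<longleftrightarrow> \<bar>fst x - fst y\<bar> \<le> r \<and> \<bar>snd x - snd y\<bar> \<le> r
     \<and> \<bar>(fst x + snd x) - (fst y + snd y)\<bar> \<le> r"
  by (cases x; cases y) (simp add: lattice_dist_def)

lemma lattice_dist_triangle: "lattice_dist x z \<le> lattice_dist x y + lattice_dist y z"
proof -
  have "\<bar>p - r\<bar> \<le> m + n" if "\<bar>p - q\<bar> \<le> m" "\<bar>q - r\<bar> \<le> n" for p q r m n :: int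
    using that by linarith
  then show ?thesis
    using lattice_dist_le_iff[of x y, THEN iffD1, OF order_refl]
      lattice_dist_le_iff[of y z, THEN iffD1, OF order_refl]
    unfolding lattice_dist_le_iff[of x z] by blast
qed

text \<open>Walk from \<open>u\<close> to \<open>w\<close> by unit steps, first in one coordinate
  and then in the other. The last point before the walk first leaves \<open>V\<close> is a boundary
  point, whatever the shape of \<open>V\<close>.\<close>

lemma boundary_between:
  assumes "u \<in> V" "w \<notin> V"
  shows "\<exists>x\<in>boundary V. lattice_dist u x \<le> \<bar>fst u - fst w\<bar> + \<bar>snd u - snd w\<bar>"
  using assms(1)
proof (induction "nat (\<bar>fst u - fst w\<bar> + \<bar>snd u - snd w\<bar>)" arbitrary: u rule: less_induct)
  case less
  obtain a b where u: "u = (a, b)" by fastforce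
  obtain c d where w: "w = (c, d)" by fastforce
  define u' where "u' = (if a < c then (a + 1, b) else if a > c then (a - 1, b)
    else if b < d then (a, b + 1) else (a, b - 1))"
  \<comment> \<open>This makes the last branch of \<open>u'\<close> a step towards \<open>w\<close>:
    there \<open>a = c\<close>, and \<open>b\<close> must exceed \<open>d\<close>.\<close>
  have "(a, b) \<noteq> (c, d)" using less.prems assms(2) u w by auto
  then have u': "lattice_dist u u' = 1"
    "\<bar>fst u' - fst w\<bar> + \<bar>snd u' - snd w\<bar> = \<bar>fst u - fst w\<bar> + \<bar>snd u - snd w\<bar> - 1"
    unfolding u w u'_def lattice_dist_def by auto
  show ?case
  proof (cases "u' \<in> V")
    case True
    have "0 \<le> \<bar>fst u' - fst w\<bar> + \<bar>snd u' - snd w\<bar>" by simp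
    then obtain x where x: "x \<in> boundary V"
      "lattice_dist u' x \<le> \<bar>fst u' - fst w\<bar> + \<bar>snd u' - snd w\<bar>"
      using less.hyps[of u'] True u'(2) by (auto simp: zless_nat_eq_int_zless)
    have "lattice_dist u x \<le> lattice_dist u u' + lattice_dist u' x"
      by (rule lattice_dist_triangle)
    then show ?thesis using x u' by (intro bexI[of _ x]) auto
  next
    case False
    then have "u \<in> boundary V" using u' less.prems unfolding boundary_def by blast
    moreover have "lattice_dist u u = 0" by (simp add: lattice_dist_def u)
    ultimately show ?thesis by (intro bexI[of _ u]) auto
  qed
qed

text \<open>
  The rows of twelve points starting at \<open>centres\<close> partition the plane as well as the tiles do, and
  the faces are easier to attribute to them.
\<close>

definition row_faces :: "point \<Rightarrow> point set set" where
  "row_faces z = (\<lambda>k. face_up (z + (k, 0))) ` {0..<12} \<union> (\<lambda>k. face_down (z + (k, 0))) ` {0..<12}"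

lemma card_row_faces: "card (row_faces z) \<le> 24"
proof -
  have "card ((\<lambda>k. f (z + (k, 0))) ` {0..<12::int}) \<le> 12" for f :: "point \<Rightarrow> point set"
    using card_image_le[of "{0..<12::int}"] by (metis card_atLeastLessThan_int diff_zero
      finite_atLeastLessThan_int nat_numeral)
  then show ?thesis
    unfolding row_faces_def by (intro order.trans[OF card_Un_le]) (metis add_mono numeral_Bit0)
qed

lemma row_faces_cover:
  assumes "T \<in> triangles V"
  shows "\<exists>z\<in>centres. T \<in> row_faces z"
proof -
  obtain a b where T: "T = face_up (a, b) \<or> T = face_down (a, b)"
    using assms by (auto simp: triangles_def)
  \<comment> \<open>Moving left by \<open>?k\<close> lowers \<open>a + 3 * b\<close> by its own
    residue, which leads to the start of the row.\<close>
  let ?k = "(a + 3 * b) mod 12"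
  have "12 dvd (a + 3 * b) - ?k" by (rule dvd_minus_mod)
  then have "(a - ?k, b) \<in> centres" by (simp add: centres_def algebra_simps)
  moreover have "T \<in> row_faces (a - ?k, b)"
  proof -
    have "(a, b) = (a - ?k, b) + (?k, 0)" "?k \<in> {0..<12}" by auto
    then show ?thesis using T unfolding row_faces_def by (metis (no_types, lifting) UnI1 UnI2 imageI)
  qed
  ultimately show ?thesis by blast
qed

lemma partial_row_near_boundary:
  assumes "T \<in> triangles V" "T \<in> row_faces z" "\<not> (+) z ` tile \<subseteq> V"
  shows "T \<in> triangles_near_boundary 16 V"
proof -
  obtain a b where z: "z = (a, b)" by fastforce
  \<comment> \<open>The point \<open>(a + k + 1, b)\<close> is a vertex of both the upward and the
    downward face based at \<open>(a + k, b)\<close>.\<close>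
  obtain k where k: "0 \<le> k" "k < 12" "(a + k + 1, b) \<in> T"
    using assms(2) by (auto simp: row_faces_def z face_up_def face_down_def)
  obtain x where x: "x \<in> tile" "z + x \<notin> V" using assms(3) by blast
  have "(a + k + 1, b) \<in> V" using assms(1) k by (auto simp: triangles_def)
  then obtain y where y: "y \<in> boundary V" "lattice_dist (a + k + 1, b) y
      \<le> \<bar>a + k + 1 - fst (z + x)\<bar> + \<bar>b - snd (z + x)\<bar>"
    using boundary_between[of "(a + k + 1, b)" V "z + x"] x by auto
  have "fst x \<in> {0..3}" "snd x \<in> {0..4}" using x by (auto simp: tile_eq)
  \<comment> \<open>The radius 16 is 12 + 4: \<open>k + 1\<close> lies in 1..12 and
    \<open>fst x\<close> in 0..3, so the horizontal gap is at most 12; the vertical gap is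
    \<open>snd x\<close>, at most 4.\<close>
  then have "\<bar>a + k + 1 - fst (z + x)\<bar> + \<bar>b - snd (z + x)\<bar> \<le> 16" using k by (auto simp: z)
  then have "lattice_dist (a + k + 1, b) y \<le> int 16" using y by simp
  then show ?thesis
    using k y assms(1) unfolding triangles_near_boundary_def by blast
qed

text \<open>Every face lies in the row of some centre. If the tile of that centre is complete, the
  face is among the at most 24 of that row; otherwise it is near the boundary.\<close>

lemma card_triangles_le:
  assumes "finite V"
  shows "card (triangles V) \<le> 24 * card (full_centres V) + card (triangles_near_boundary 16 V)"
proof -
  let ?R = "\<Union>z\<in>full_centres V. row_faces z" and ?N = "triangles_near_boundary 16 V"
  have fin: "finite ?R" "finite ?N"
    using finite_full_centres[OF assms] finite_triangles[OF assms]
    by (auto simp: row_faces_def triangles_near_boundary_def)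
  have "triangles V \<subseteq> ?R \<union> ?N"
    using row_faces_cover partial_row_near_boundary by (fastforce simp: full_centres_def)
  then have "card (triangles V) \<le> card (?R \<union> ?N)" using fin by (intro card_mono) auto
  also have "\<dots> \<le> card ?R + card ?N" by (rule card_Un_le)
  also have "card ?R \<le> (\<Sum>z\<in>full_centres V. card (row_faces z))"
    by (rule card_UN_le[OF finite_full_centres[OF assms]])
  also have "\<dots> \<le> card (full_centres V) * 24"
    using sum_bounded_above[of "full_centres V" "\<lambda>z. card (row_faces z)" 24] card_row_faces by simp
  finally show ?thesis by simp
qed

theorem theorem8:
  fixes \<G> :: "point set set"
  assumes "\<And>V. V \<in> \<G> \<Longrightarrow> finite V"
    and "two_dimensional \<G>"
  shows "\<exists>\<epsilon> :: nat \<Rightarrow> real. \<epsilon> \<in> o(\<lambda>n. real n) \<and>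
           (\<forall>V\<in>\<G>. real (SC2 V (triangles V) 3)
                    \<ge> real (card (triangles V)) / 28 - \<epsilon> (card (triangles V)))"
proof -
  obtain \<beta> :: "nat \<Rightarrow> real" where \<beta>: "\<beta> \<in> o(\<lambda>n. real n)"
    "\<And>V. V \<in> \<G> \<Longrightarrow> real (card (triangles_near_boundary 16 V)) \<le> \<beta> (card (triangles V))"
    using assms(2) unfolding two_dimensional_def by blast
  have "real (card (triangles V)) / 28 - \<beta> (card (triangles V)) \<le> real (SC2 V (triangles V) 3)"
    if "V \<in> \<G>" for V
  proof -
    have "card (triangles V) \<le> 24 * SC2 V (triangles V) 3 + card (triangles_near_boundary 16 V)"
      using card_triangles_le[OF assms(1)[OF that]] card_full_centres_le_SC2[OF assms(1)[OF that]]
      by linarith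
    then have "real (card (triangles V))
        \<le> 24 * real (SC2 V (triangles V) 3) + \<beta> (card (triangles V))"
      using \<beta>(2)[OF that] by linarith
    \<comment> \<open>The counting gives the error \<open>\<beta> / 24\<close>; nonnegativity allows
      weakening it to \<open>\<beta>\<close>, just as n/24 is weakened to n/28.\<close>
    moreover have "0 \<le> \<beta> (card (triangles V))"
      using \<beta>(2)[OF that] of_nat_0_le_iff order.trans by blast
    ultimately show ?thesis by simp
  qed
  then show ?thesis using \<beta>(1) by blast
qed

end
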